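(* Let $F$ be a field of characteristic different from $2$, and for $n\ge 2$ and $d_1,\ldots,d_n\in F\setminus\{0\}$ let $J_{n+1}(f)$ be the simple Jordan algebra over $F$ of the form $f=(d_1,\ldots,d_n)$. Then the following hold. a) Suppose $n\ge 3$. If $F$ contains a square root $i$ of $-1$ and there exist pairwise distinct $j_1,j_2,j_3\in\{1,\ldots,n\}$ such that each $d_{j_s}$, $s=1,2,3$, is a square in $F$, then $\mathrm{rb}(J_{n+1}(f))=3$. b) Suppose $F=\mathbb{R}$ and $n\ge 3$. Then $$\mathrm{rb}(J_{n+1}(f))=\begin{cases}1, & \text{if } d_1,\ldots,d_n<0,\\ 2, & \text{if } d_1,\ldots,d_n>0, \text{ or if there is an index } i \text{ with } d_i>0 \text{ and } d_j<0 \text{ for all } j\ne i,\\ 3, & \text{otherwise.}\end{cases}$$ c) If $F$ is a finite field, then $\mathrm{rb}(J_k(f))=3$ for all $k\ge 6$ (where $f=(d_1,\ldots,d_{k-1})$). d) If $F=\mathbb{Z}_p$ for a prime $p$ of the form $4t+1$, then for $k\ge 3$ and $f=(d_1,\ldots,d_{k-1})$, $$\mathrm{rb}(J_k(f))=\begin{cases}2, & \text{if } k=3, \text{ or } k=4 \text{ and the number of quadratic residues modulo } p \text{ among } d_1,d_2,d_3 \text{ is even},\\ 3, & \text{if } k\ge 5, \text{ or } k=4 \text{ and the number of quadratic residues modulo } p \text{ among } d_1,d_2,d_3 \text{ is odd}.\end{cases}$$ e) If $F=\mathbb{Z}_p$ for a prime $p$ of the form $4t+3$, then for $k\ge 3$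 and $f=(d_1,\ldots,d_{k-1})$, $$\mathrm{rb}(J_k(f))=\begin{cases}2, & \text{if } k=3, \text{ or } k=4 \text{ and the number of quadratic residues modulo } p \text{ among } d_1,d_2,d_3 \text{ is odd},\\ 3, & \text{if } k\ge 5, \text{ or } k=4 \text{ and the number of quadratic residues modulo } p \text{ among } d_1,d_2,d_3 \text{ is even}.\end{cases}$$
   Context: For $n\geq2$ and nonzero $d_1,\ldots,d_n\in F$, $J_{n+1}(f)$ with $f=(d_1,\ldots,d_n)$ denotes the $(n+1)$-dimensional algebra $F\cdot1\oplus V$, where $V$ has basis $e_1,\ldots,e_n$ and $f$ is the nondegenerate symmetric bilinear form on $V$ with $f(e_i,e_i)=d_i$ and $f(e_i,e_j)=0$ for $i\ne j$; the product is $(\alpha\cdot1+v)(\beta\cdot1+u)=(\alpha\beta+f(v,u))\cdot1+(\alpha u+\beta v)$ for $\alpha,\beta\in F$, $u,v\in V$. Thus the subscript is the dimension of the algebra, and $J_k(f)$ corresponds to a form $f=(d_1,\ldots,d_{k-1})$. A Rota--Baxter operator of weight zero on an algebra $A$ over $F$ is a linear map $R\colon A\to A$ such that $R(x)R(y)=R(R(x)y+xR(y))$ for all $x,y\in A$. $\mathrm{rb}(J)$ denotes the minimal natural number $s\geq 1$ such that $R^s=0$ for every Rota--Baxter operator $R$ of weight zero on $J$. $\mathbb{Z}_p$ is the field with $p$ elements; a quadratic residue modulo $p$ is a nonzero square in $\mathbb{Z}_p$. *)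

theory Defs
  imports
    "HOL-Analysis.Analysis"
    "HOL-Computational_Algebra.Nth_Powers"
begin

text \<open>
  The form given by \<open>(d\<^sub>1, \<dots>, d\<^sub>n)\<close> on \<open>V = F\<^sup>n\<close>, with \<open>e\<^sub>j = axis j 1\<close>. The index set
  \<open>{1, \<dots>, n}\<close> is replaced by a finite type \<open>'n\<close> with \<open>CARD('n) = n\<close>.
\<close>

definition diag_form :: "('n::finite \<Rightarrow> 'a::field) \<Rightarrow> 'a ^ 'n \<Rightarrow> 'a ^ 'n \<Rightarrow> 'a" where
  "diag_form d v u = (\<Sum>j\<in>UNIV. d j * v $ j * u $ j)"

lemma diag_form_axis: "diag_form d (axis i 1) (axis j 1) = (if i = j then d i else 0)"
proof -
  have "diag_form d (axis i 1) (axis j 1) = (\<Sum>k\<in>UNIV. if k = i then (if i = j then d i else 0) else 0)"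
    unfolding diag_form_def by (intro sum.cong) (auto simp: axis_def)
  then show ?thesis by simp
qed

text \<open>The algebra \<open>F \<cdot> 1 \<oplus> V\<close>: the pair \<open>(\<alpha>, v)\<close> stands for \<open>\<alpha> \<cdot> 1 + v\<close>.\<close>

definition J_scale :: "'a::field \<Rightarrow> 'a \<times> ('a ^ 'n) \<Rightarrow> 'a \<times> ('a ^ 'n)" where
  "J_scale c x = (c * fst x, c *s snd x)"

definition J_mult :: "('a::field ^ 'n \<Rightarrow> 'a ^ 'n \<Rightarrow> 'a) \<Rightarrow>
    'a \<times> ('a ^ 'n) \<Rightarrow> 'a \<times> ('a ^ 'n) \<Rightarrow> 'a \<times> ('a ^ 'n)" where
  "J_mult f x y = (fst x * fst y + f (snd x) (snd y), fst x *s snd y + fst y *s snd x)"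

definition rota_baxter :: "('a::field \<Rightarrow> 'b::ab_group_add \<Rightarrow> 'b) \<Rightarrow> ('b \<Rightarrow> 'b \<Rightarrow> 'b) \<Rightarrow>
    ('b \<Rightarrow> 'b) \<Rightarrow> bool" where
  "rota_baxter sc mul R \<longleftrightarrow> Vector_Spaces.linear sc sc R \<and>
     (\<forall>x y. mul (R x) (R y) = R (mul (R x) y + mul x (R y)))"

definition rb_bound :: "('a::field \<Rightarrow> 'b::ab_group_add \<Rightarrow> 'b) \<Rightarrow> ('b \<Rightarrow> 'b \<Rightarrow> 'b) \<Rightarrow> nat \<Rightarrow> bool" where
  "rb_bound sc mul s \<longleftrightarrow> s \<ge> 1 \<and> (\<forall>R. rota_baxter sc mul R \<longrightarrow> R ^^ s = (\<lambda>_. 0))"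

text \<open>
  The value \<open>0\<close> means that no bound exists, so \<open>rb_index sc mul = s\<close> with \<open>s \<ge> 1\<close> includes
  the claim that all Rota--Baxter operators of weight zero are nilpotent of index at most \<open>s\<close>.
\<close>

definition rb_index :: "('a::field \<Rightarrow> 'b::ab_group_add \<Rightarrow> 'b) \<Rightarrow> ('b \<Rightarrow> 'b \<Rightarrow> 'b) \<Rightarrow> nat" where
  "rb_index sc mul =
     (if \<exists>s. rb_bound sc mul s then LEAST s. rb_bound sc mul s else 0)"

definition rb_J :: "('n::finite \<Rightarrow> 'a::field) \<Rightarrow> nat" where
  "rb_J d = rb_index J_scale (J_mult (diag_form d))"

lemma vector_space_J_scale: "vector_space (J_scale :: 'a::field \<Rightarrow> 'a \<times> ('a ^ 'n) \<Rightarrow> _)"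
  by unfold_locales (simp_all add: J_scale_def algebra_simps vec_eq_iff)

definition quadratic_residue :: "'a::field \<Rightarrow> bool" where
  "quadratic_residue a \<longleftrightarrow> a \<noteq> 0 \<and> is_square a"

text \<open>The number of indices, so residues among the \<open>d\<^sub>j\<close> are counted with multiplicity.\<close>

definition num_quadratic_residues :: "('n::finite \<Rightarrow> 'a::field) \<Rightarrow> nat" where
  "num_quadratic_residues d = card {j. quadratic_residue (d j)}"

end

theory Submission
  imports Defs "HOL-Number_Theory.Residues"
begin

text \<open>
  Let \<open>\<tau>(\<alpha> + v) = \<alpha>\<close>, and extend \<open>f\<close> to \<open>J\<close> by \<open>g(\<alpha> + v, \<beta> + u) = f(v, u) - \<alpha>\<beta>\<close>. Then
  \<open>xy = \<tau>(x)y + \<tau>(y)x + g(x, y)1\<close>, so the whole product is governed by the linear functional \<open>\<tau>\<close>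
  and the form \<open>g\<close>. If \<open>R\<close> is a Rota--Baxter operator, then \<open>1\<close> is not in its range: \<open>R z = 1\<close> would
  give \<open>1 = R z R z = R(2z) = 2\<close>. The range is closed under multiplication, so it is totally
  isotropic for \<open>g\<close>. Inserting the product formula into the Rota--Baxter identity turns it into
  \<open>\<tau>(y)R\<^sup>2x + \<tau>(x)R\<^sup>2y + (g(Rx, y) + g(x, Ry))R(1) = 0\<close> (lemma \<open>rota_baxter_iff\<close>).

  Putting \<open>y = 1\<close> and writing \<open>c = R(1)\<close>, one finds that \<open>c\<close> lies in \<open>V\<close>, with \<open>f(c, c) = 0\<close>
  and \<open>Rc = 0\<close>, and that \<open>R\<^sup>2x\<close> is a multiple of \<open>c\<close> for every \<open>x\<close>. Hence \<open>R\<^sup>3 = 0\<close>, over any field of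
  characteristic different from 2, and the index is 1, 2 or 3. Which one occurs depends only on
  the vectors that \<open>f\<close> provides (theorem \<open>rb_J_eq\<close>):

  \<^item> Some \<open>R\<^sup>2\<close> is nonzero iff \<open>V\<close> contains \<open>u\<close> and \<open>c \<noteq> 0\<close> with \<open>f(u, u) = 1\<close>, \<open>f(c, c) = 0\<close> and
    \<open>f(u, c) = 0\<close>. Given such a pair, \<open>R(x) = (\<tau>(x) + f(x, u))c - f(x, c)(1 + u)\<close> is an example.

  \<^item> Some \<open>R\<close> is nonzero iff \<open>g\<close> is isotropic, that is, iff \<open>f(v, v)\<close> is a square for some \<open>v \<noteq> 0\<close>.
    Given such a vector, any rank-one operator onto an isotropic line whose kernel contains that
    line and \<open>1\<close> is an example.

  What remains is a question about diagonal quadratic forms. Over the reals it is answered by the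
  signature. Over a finite field of odd order, binary forms are universal, so the second condition
  always holds; the first one says that the orthogonal complement of some unit vector is isotropic,
  which is impossible in dimension 2, automatic in dimension at least 4, and in dimension 3
  equivalent to \<open>- d\<^sub>1 d\<^sub>2 d\<^sub>3\<close> being a square. Since a product of two nonsquares is a square, this
  depends only on the number of residues among the \<open>d\<^sub>j\<close> and on whether \<open>- 1\<close> is a square, that is,
  on the order of the field modulo 4.
\<close>

section \<open>Rota--Baxter operators on the algebra of a form\<close>

lemma J_scale_pair [simp]: "J_scale c (a, v) = (c * a, c *s v)"
  by (simp add: J_scale_def)

lemma pair_eq_0_iff [simp]: "(a, b) = 0 \<longleftrightarrow> a = 0 \<and> b = 0"
  by (simp add: zero_prod_def)

(* Statements about all x in J must not be split into components: they serve as rewrite rules for R x. *)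
declare split_paired_All [simp del] split_paired_Ex [simp del]

lemma linear_J_scale_iff:
  "Vector_Spaces.linear J_scale J_scale R \<longleftrightarrow>
     (\<forall>x y. R (x + y) = R x + R y) \<and> (\<forall>c x. R (J_scale c x) = J_scale c (R x))"
  by (simp add: Vector_Spaces.linear_iff vector_space_J_scale)

locale symmetric_form =
  fixes f :: "'a::field ^ 'n::finite \<Rightarrow> 'a ^ 'n \<Rightarrow> 'a"
  assumes sym: "f v w = f w v"
    and add_left: "f (u + v) w = f u w + f v w"
    and scale_left: "f (c *s v) w = c * f v w"
begin

lemma add_right: "f w (u + v) = f w u + f w v"
  using add_left sym by metis

lemma scale_right: "f w (c *s v) = c * f w v"
  using scale_left sym by metis

lemma zero_left [simp]: "f 0 w = 0"
  using scale_left[of 0 0 w] by simp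

lemma zero_right [simp]: "f w 0 = 0"
  using sym zero_left by metis

lemma minus_left: "f (- v) w = - f v w"
  using scale_left[of "-1" v w] by simp

lemma minus_right: "f w (- v) = - f w v"
  using minus_left sym by metis

lemma diff_left: "f (u - v) w = f u w - f v w"
  using add_left[of u "-v" w] by (simp add: minus_left)

lemma diff_right: "f w (u - v) = f w u - f w v"
  using diff_left sym by metis

lemmas form_simps = add_left add_right scale_left scale_right minus_left minus_right
  diff_left diff_right

text \<open>
  The orthogonal sum of \<open>f\<close> and \<open>\<langle>- 1\<rangle>\<close>. It is minus the polarization of the generic norm of the
  algebra, and it is the coefficient of \<open>1\<close> left over when a product is compared with the linear
  combination \<open>\<tau>(x)y + \<tau>(y)x\<close> of its factors.
\<close>

definition extended_form :: "'a \<times> ('a ^ 'n) \<Rightarrow> 'a \<times> ('a ^ 'n) \<Rightarrow> 'a" where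
  "extended_form x y = f (snd x) (snd y) - fst x * fst y"

abbreviation rota_baxter_J :: "('a \<times> ('a ^ 'n) \<Rightarrow> 'a \<times> ('a ^ 'n)) \<Rightarrow> bool" where
  "rota_baxter_J \<equiv> rota_baxter J_scale (J_mult f)"

lemma J_mult_eq:
  "J_mult f x y =
     J_scale (fst x) y + J_scale (fst y) x + J_scale (extended_form x y) (1, 0)"
  by (cases x; cases y) (simp add: J_mult_def extended_form_def algebra_simps)

lemma extended_form_unit [simp]:
  "extended_form x (1, 0) = - fst x" "extended_form (1, 0) x = - fst x"
  by (simp_all add: extended_form_def)

lemma J_mult_unit [simp]: "J_mult f (1, 0) x = x" "J_mult f x (1, 0) = x"
  by (simp_all add: J_mult_def)

lemma unit_not_in_range:
  assumes "rota_baxter_J R"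
  shows "R z \<noteq> (1, 0)"
proof
  assume z: "R z = (1, 0)"
  have "J_mult f (R z) (R z) = R (J_mult f (R z) z + J_mult f z (R z))"
    using assms by (simp add: rota_baxter_def)
  also have "\<dots> = R z + R z"
    using assms by (simp add: z rota_baxter_def linear_J_scale_iff)
  finally show False
    by (simp add: z) (metis add_cancel_left_left one_add_one one_neq_zero)
qed

text \<open>
  The first two summands on the right are \<open>R(x)R(y)\<close> up to a multiple of \<open>1\<close>. The bracket is
  therefore the obstruction to the Rota--Baxter identity once the range of \<open>R\<close> is isotropic.
\<close>

lemma apply_products:
  assumes "Vector_Spaces.linear J_scale J_scale R"
  shows "R (J_mult f (R x) y + J_mult f x (R y)) =
      J_scale (fst (R x)) (R y) + J_scale (fst (R y)) (R x) +
      (J_scale (fst y) (R (R x)) + J_scale (fst x) (R (R y)) +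
       J_scale (extended_form (R x) y + extended_form x (R y)) (R (1, 0)))"
proof -
  interpret V: vector_space "J_scale :: 'a \<Rightarrow> 'a \<times> ('a ^ 'n) \<Rightarrow> _"
    by (rule vector_space_J_scale)
  have R: "R (x + y) = R x + R y" "R (J_scale c x) = J_scale c (R x)" for x y c
    using assms by (auto simp: linear_J_scale_iff)
  show ?thesis
    unfolding J_mult_eq R V.scale_left_distrib by (simp add: algebra_simps)
qed

text \<open>
  The range is closed under multiplication, so it contains
  \<open>R(x)R(y) - \<tau>(Rx)R(y) - \<tau>(Ry)R(x) = g(Rx, Ry)1\<close>. A nonzero value of \<open>g\<close> would put \<open>1\<close> into the
  range.
\<close>

lemma rota_baxter_range_isotropic:
  assumes "rota_baxter_J R"
  shows "extended_form (R x) (R y) = 0"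
proof (rule ccontr)
  define k where "k = extended_form (R x) (R y)"
  assume "extended_form (R x) (R y) \<noteq> 0"
  then have k: "k \<noteq> 0"
    by (simp add: k_def)
  interpret R: Vector_Spaces.linear "J_scale :: 'a \<Rightarrow> 'a \<times> ('a ^ 'n) \<Rightarrow> _" J_scale R
    using assms by (simp add: rota_baxter_def)
  have "J_scale k (1, 0) =
      J_mult f (R x) (R y) - J_scale (fst (R x)) (R y) - J_scale (fst (R y)) (R x)"
    by (simp add: J_mult_eq k_def)
  also have "\<dots> = R (J_mult f (R x) y + J_mult f x (R y) - J_scale (fst (R x)) y - J_scale (fst (R y)) x)"
    using assms by (simp add: rota_baxter_def R.diff R.scale)
  finally have "R (J_scale (1 / k) (J_mult f (R x) y + J_mult f x (R y) - J_scale (fst (R x)) y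
      - J_scale (fst (R y)) x)) = J_scale (1 / k) (J_scale k (1, 0))"
    by (simp only: R.scale)
  also have "\<dots> = (1, 0)"
    using k by simp
  finally have "R (J_scale (1 / k) (J_mult f (R x) y + J_mult f x (R y) - J_scale (fst (R x)) y
      - J_scale (fst (R y)) x)) = (1, 0)" .
  then show False
    using unit_not_in_range[OF assms] by blast
qed

lemma rota_baxter_iff:
  "rota_baxter_J R \<longleftrightarrow>
    Vector_Spaces.linear J_scale J_scale R \<and>
    (\<forall>x y. extended_form (R x) (R y) = 0) \<and>
    (\<forall>x y. J_scale (fst y) (R (R x)) + J_scale (fst x) (R (R y)) +
       J_scale (extended_form (R x) y + extended_form x (R y)) (R (1, 0)) = 0)"
    (is "_ \<longleftrightarrow> ?lin \<and> ?iso \<and> ?id")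
proof -
  interpret V: vector_space "J_scale :: 'a \<Rightarrow> 'a \<times> ('a ^ 'n) \<Rightarrow> _"
    by (rule vector_space_J_scale)
  have "rota_baxter_J R \<longleftrightarrow> ?id" if lin: ?lin and iso: ?iso
  proof -
    have "J_mult f (R x) (R y) = R (J_mult f (R x) y + J_mult f x (R y)) \<longleftrightarrow>
        J_scale (fst y) (R (R x)) + J_scale (fst x) (R (R y)) +
        J_scale (extended_form (R x) y + extended_form x (R y)) (R (1, 0)) = 0" for x y
      unfolding apply_products[OF lin] J_mult_eq[of "R x" "R y"] iso[rule_format]
        V.scale_zero_left add_0_right by (metis add_cancel_left_right)
    then show ?thesis
      using lin by (simp only: rota_baxter_def simp_thms)
  qed
  then show ?thesis
    using rota_baxter_range_isotropic rota_baxter_def by blast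
qed

context
  fixes R
  assumes R: "rota_baxter_J R"
begin

interpretation V: vector_space "J_scale :: 'a \<Rightarrow> 'a \<times> ('a ^ 'n) \<Rightarrow> _"
  by (rule vector_space_J_scale)

interpretation R: Vector_Spaces.linear "J_scale :: 'a \<Rightarrow> 'a \<times> ('a ^ 'n) \<Rightarrow> _" J_scale R
  using R by (simp add: rota_baxter_def)

lemma rota_baxter_identity:
  "J_scale (fst y) (R (R x)) + J_scale (fst x) (R (R y)) +
     J_scale (extended_form (R x) y + extended_form x (R y)) (R (1, 0)) = 0"
  using R by (simp add: rota_baxter_iff)

text \<open>
  All three claims come from the identity with \<open>y = 1\<close>. For \<open>c = R(1)\<close> and \<open>t = \<tau>(c)\<close>, also taking
  \<open>x = 1\<close> gives \<open>2(Rc - tc) = 0\<close>. With this, a general \<open>x\<close> gives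
  \<open>R\<^sup>2x = (\<tau>(Rx) - t\<tau>(x) - g(x, c))c\<close>. Evaluated at the isotropic \<open>c\<close>, the left side is \<open>t\<^sup>2c\<close> and
  the right side is \<open>(t\<^sup>2 - t\<^sup>2)c = 0\<close>, so \<open>t = 0\<close>.
\<close>

lemma rota_baxter_square:
  assumes two: "(2::'a) \<noteq> 0"
  shows "fst (R (1, 0)) = 0" "R (R (1, 0)) = 0"
    "R (R x) = J_scale (fst (R x) - extended_form x (R (1, 0))) (R (1, 0))"
proof -
  define c t where "c = R (1, 0)" and "t = fst c"
  have "J_scale 2 (R c - J_scale t c) = 0"
    using rota_baxter_identity[of "(1, 0)" "(1, 0)"]
    by (simp add: t_def c_def[symmetric] algebra_simps prod_eq_iff vec_eq_iff J_scale_def)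
  then have Rc: "R c = J_scale t c"
    using two by simp
  have sq: "R (R x) = J_scale (fst (R x) - t * fst x - extended_form x c) c" for x
  proof -
    have "R (R x) + J_scale (fst x * t) c - J_scale (fst (R x) - extended_form x c) c = 0"
      using rota_baxter_identity[of "(1, 0)" x]
      by (simp add: c_def[symmetric] Rc V.scale_left_diff_distrib algebra_simps)
    then show ?thesis
      by (simp add: V.scale_left_diff_distrib algebra_simps)
  qed
  have "extended_form c c = 0"
    using rota_baxter_range_isotropic[OF R] by (simp add: c_def)
  then have "J_scale (t * t) c = 0"
    using sq[of c] by (simp add: Rc R.scale) (simp add: J_scale_def t_def)
  then have t: "t = 0"
    by (auto simp: t_def)
  then show "fst (R (1, 0)) = 0" "R (R (1, 0)) = 0"
    "R (R x) = J_scale (fst (R x) - extended_form x (R (1, 0))) (R (1, 0))"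
    using Rc sq by (simp_all add: c_def t_def)
qed

lemma rota_baxter_cubed:
  assumes "(2::'a) \<noteq> 0"
  shows "R ^^ 3 = (\<lambda>_. 0)"
  using rota_baxter_square(2,3)[OF assms] by (simp add: fun_eq_iff numeral_3_eq_3 R.scale)

text \<open>
  If \<open>R\<^sup>2x \<noteq> 0\<close>, then \<open>c = R(1) \<noteq> 0\<close>, and after rescaling \<open>x\<close> the element \<open>b = Rx = \<beta> + u\<close> satisfies
  \<open>Rb = c\<close>. Isotropy of the range gives \<open>f(c, c) = 0\<close>, \<open>f(u, c) = 0\<close> and \<open>f(u, u) = \<beta>\<^sup>2\<close>, so \<open>u/\<beta>\<close> and
  \<open>c\<close> form the required pair as soon as \<open>\<beta> \<noteq> 0\<close>. If \<open>\<beta>\<close> were \<open>0\<close>, the identity for \<open>b\<close> and a vector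
  \<open>w\<close> would reduce to \<open>f(w, c)c = 0\<close>, which nondegeneracy excludes.
\<close>

lemma unit_null_pair_if_square_nonzero:
  assumes two: "(2::'a) \<noteq> 0"
    and nondegenerate: "\<And>v. v \<noteq> 0 \<Longrightarrow> \<exists>w. f v w \<noteq> 0"
    and nz: "R (R x) \<noteq> 0"
  shows "\<exists>u c. f u u = 1 \<and> c \<noteq> 0 \<and> f c c = 0 \<and> f u c = 0"
proof -
  define c where "c = snd (R (1, 0))"
  define l where "l y = fst (R y) - f (snd y) c" for y
  have c: "R (1, 0) = (0, c)"
    using rota_baxter_square(1)[OF two] by (simp add: c_def prod_eq_iff)
  have sq: "R (R y) = J_scale (l y) (0, c)" for y
    using rota_baxter_square(3)[OF two, of y] by (simp add: c l_def extended_form_def)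
  define b where "b = R (J_scale (1 / l x) x)"
  from nz have lx: "l x \<noteq> 0" and c0: "c \<noteq> 0"
    unfolding sq by auto
  have Rb: "R b = (0, c)"
    using lx by (simp add: b_def R.scale sq)
  have iso: "f c c = 0" "f (snd b) c = 0" "f (snd b) (snd b) = fst b * fst b"
    using rota_baxter_range_isotropic[OF R, of "(1, 0)" "(1, 0)"]
      rota_baxter_range_isotropic[OF R, of "J_scale (1 / l x) x" "(1, 0)"]
      rota_baxter_range_isotropic[OF R, of "J_scale (1 / l x) x" "J_scale (1 / l x) x"]
    by (simp_all add: c extended_form_def flip: b_def)
  have "fst b \<noteq> 0"
  proof
    assume b0: "fst b = 0"
    obtain w where w: "f c w \<noteq> 0"
      using nondegenerate c0 by blast
    have "extended_form (R (0, w)) b = 0"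
      using rota_baxter_range_isotropic[OF R, of "(0, w)" "J_scale (1 / l x) x"] by (simp flip: b_def)
    then have "J_scale (f w c) (0, c) = 0"
      using rota_baxter_identity[of b "(0, w)"]
      by (simp add: b0 Rb c extended_form_def)
    then show False
      using w c0 sym[of c w] by simp
  qed
  then have "f ((1 / fst b) *s snd b) ((1 / fst b) *s snd b) = 1"
    "f ((1 / fst b) *s snd b) c = 0"
    by (simp_all add: form_simps iso)
  with c0 iso(1) show ?thesis
    by blast
qed

text \<open>A nonzero \<open>\<alpha> + v\<close> in the isotropic range satisfies \<open>f(v, v) = \<alpha>\<^sup>2\<close>, which forces \<open>v \<noteq> 0\<close>.\<close>

lemma nonzero_square_value_if_nonzero:
  assumes "R \<noteq> (\<lambda>_. 0)"
  shows "\<exists>v. v \<noteq> 0 \<and> is_square (f v v)"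
proof -
  obtain x where x: "R x \<noteq> 0"
    using assms by blast
  have *: "f (snd (R x)) (snd (R x)) = fst (R x) ^ 2"
    using rota_baxter_range_isotropic[OF R, of x x] by (simp add: extended_form_def power2_eq_square)
  moreover have "snd (R x) \<noteq> 0"
    using x * by (auto simp: prod_eq_iff)
  ultimately show ?thesis
    by auto
qed

end

text \<open>
  The operator has range spanned by the isotropic vectors \<open>c\<close> and \<open>1 + u\<close>, which are orthogonal for
  \<open>g\<close>, and \<open>R\<^sup>2x = - 2 f(x, c) c\<close>. It is found by solving the conditions of \<open>rota_baxter_iff\<close> in a basis
  \<open>1, u, c, c'\<close> with \<open>f(c, c') = 1\<close>: requiring \<open>R(1) = c\<close>, \<open>R(u) = \<nu>c\<close>, \<open>R(c') = \<gamma>(1 + u)\<close> leaves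
  \<open>\<nu> = - \<gamma>\<close> and \<open>\<gamma>\<^sup>2 = 1\<close>, and \<open>\<gamma> = 1\<close> has square zero.
\<close>

lemma rota_baxter_with_nonzero_square:
  assumes two: "(2::'a) \<noteq> 0"
    and nondegenerate: "\<And>v. v \<noteq> 0 \<Longrightarrow> \<exists>w. f v w \<noteq> 0"
    and u: "f u u = 1" and c: "c \<noteq> 0" "f c c = 0" "f u c = 0"
  shows "\<exists>R. rota_baxter_J R \<and> R ^^ 2 \<noteq> (\<lambda>_. 0)"
proof -
  define R :: "'a \<times> ('a ^ 'n) \<Rightarrow> 'a \<times> ('a ^ 'n)" where
    "R x = (- f (snd x) c, (fst x + f (snd x) u) *s c - f (snd x) c *s u)" for x
  have c': "f c u = 0"
    using c sym[of c u] by simp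
  have RR: "R (R x) = (0, (- 2 * f (snd x) c) *s c)" for x
    by (simp add: R_def form_simps u c c' vec_eq_iff algebra_simps)
  have "rota_baxter_J R"
    unfolding rota_baxter_iff linear_J_scale_iff
  proof (intro conjI allI)
    show "R (x + y) = R x + R y" for x y
      by (simp add: R_def form_simps vec_eq_iff algebra_simps)
    show "R (J_scale k x) = J_scale k (R x)" for k x
      by (cases x) (simp add: R_def form_simps vec_eq_iff algebra_simps)
    show "extended_form (R x) (R y) = 0" for x y
      by (simp add: R_def extended_form_def form_simps u c c')
    show "J_scale (fst y) (R (R x)) + J_scale (fst x) (R (R y)) +
       J_scale (extended_form (R x) y + extended_form x (R y)) (R (1, 0)) = 0" for x y
      unfolding RR
      by (simp add: R_def extended_form_def form_simps sym[of c "snd y"] sym[of u "snd y"]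
          prod_eq_iff algebra_simps)
  qed
  moreover obtain w where "f c w \<noteq> 0"
    using nondegenerate c by blast
  then have "R (R (0, w)) \<noteq> 0"
    unfolding RR using two c sym[of w c] by simp
  then have "R ^^ 2 \<noteq> (\<lambda>_. 0)"
    by (auto simp: numeral_2_eq_2 fun_eq_iff)
  ultimately show ?thesis
    by blast
qed

lemma nonzero_rota_baxter:
  assumes card: "CARD('n) \<ge> 2" and v: "v \<noteq> 0" "is_square (f v v)"
  shows "\<exists>R. rota_baxter_J R \<and> R \<noteq> (\<lambda>_. 0)"
proof -
  obtain a where a: "f v v = a ^ 2"
    using v by (auto elim: is_nth_powerE)
  obtain i where i: "v $ i \<noteq> 0"
    using v by (auto simp: vec_eq_iff)
  obtain j where j: "j \<noteq> i"
    using card by (metis UNIV_I card_1_singleton_iff card_le_Suc0_iff_eq finite not_less_eq_eq numeral_2_eq_2)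
  (* p is a linear functional that kills 1 and v, so that x |-> p x (a + v) has square zero. *)
  define p where "p x = v $ j * snd x $ i - v $ i * snd x $ j" for x :: "'a \<times> ('a ^ 'n)"
  define R where "R x = J_scale (p x) (a, v)" for x
  have RR: "R (R x) = 0" for x
    by (simp add: R_def p_def algebra_simps)
  have "rota_baxter_J R"
    unfolding rota_baxter_iff linear_J_scale_iff
  proof (intro conjI allI)
    show "R (x + y) = R x + R y" for x y
      by (simp add: R_def p_def vec_eq_iff algebra_simps)
    show "R (J_scale k x) = J_scale k (R x)" for k x
      by (cases x) (simp add: R_def p_def vec_eq_iff algebra_simps)
    show "extended_form (R x) (R y) = 0" for x y
      by (simp add: R_def extended_form_def form_simps a power2_eq_square)
    show "J_scale (fst y) (R (R x)) + J_scale (fst x) (R (R y)) +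
       J_scale (extended_form (R x) y + extended_form x (R y)) (R (1, 0)) = 0" for x y
      unfolding RR by (simp add: R_def p_def J_scale_def)
  qed
  moreover have "R (0, axis j 1) \<noteq> 0"
    using i j v by (simp add: R_def p_def axis_def)
  ultimately show ?thesis
    by auto
qed

end

lemma rb_index_eqI:
  assumes s: "s \<ge> 1" and bound: "\<And>R. rota_baxter sc mul R \<Longrightarrow> R ^^ s = (\<lambda>_. 0)"
    and sharp: "s = 1 \<or> (\<exists>R. rota_baxter sc mul R \<and> R ^^ (s - 1) \<noteq> (\<lambda>_. 0))"
  shows "rb_index sc mul = s"
proof -
  have s_bound: "rb_bound sc mul s"
    using s bound by (simp add: rb_bound_def)
  have "s \<le> t" if t: "rb_bound sc mul t" for t
  proof (rule ccontr)
    assume "\<not> s \<le> t"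
    moreover from t have "t \<ge> 1"
      by (simp add: rb_bound_def)
    ultimately obtain R where R: "rota_baxter sc mul R" "R ^^ (s - 1) \<noteq> (\<lambda>_. 0)"
      using sharp by auto
    have "R ^^ (s - 1) = R ^^ t \<circ> R ^^ (s - 1 - t)"
      using \<open>\<not> s \<le> t\<close> by (simp flip: funpow_add)
    also have "\<dots> = (\<lambda>_. 0)"
      using t R by (auto simp: rb_bound_def comp_def)
    finally show False
      using R by simp
  qed
  then have "(LEAST s. rb_bound sc mul s) = s"
    using s_bound by (intro Least_equality) auto
  then show ?thesis
    using s_bound by (auto simp: rb_index_def)
qed

text \<open>
  For a nondegenerate form in characteristic different from 2 this says that \<open>\<langle>1\<rangle>\<close> splits off with
  an isotropic complement, in other words that \<open>f\<close> is the orthogonal sum of \<open>\<langle>1\<rangle>\<close>, a hyperbolic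
  plane and some further form.
\<close>

definition unit_null_pair :: "('a::field ^ 'n \<Rightarrow> 'a ^ 'n \<Rightarrow> 'a) \<Rightarrow> bool" where
  "unit_null_pair f \<longleftrightarrow> (\<exists>u c. f u u = 1 \<and> c \<noteq> 0 \<and> f c c = 0 \<and> f u c = 0)"

text \<open>Zero counts as a square: an isotropic vector of \<open>f\<close> is also one of the extended form.\<close>

definition takes_square_value :: "('a::field ^ 'n \<Rightarrow> 'a ^ 'n \<Rightarrow> 'a) \<Rightarrow> bool" where
  "takes_square_value f \<longleftrightarrow> (\<exists>v. v \<noteq> 0 \<and> is_square (f v v))"

interpretation diag_form: symmetric_form "diag_form d" for d :: "'n::finite \<Rightarrow> 'a::field"
  by unfold_locales
    (simp_all add: diag_form_def sum.distrib sum_distrib_left algebra_simps)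

lemma diag_form_axis_right: "diag_form d v (axis j 1) = d j * v $ j"
proof -
  have "diag_form d v (axis j 1) = (\<Sum>k\<in>UNIV. if k = j then d j * v $ j else 0)"
    unfolding diag_form_def by (intro sum.cong) (auto simp: axis_def)
  then show ?thesis
    by simp
qed

lemma diag_form_nondegenerate:
  assumes "\<forall>j. d j \<noteq> 0" and "v \<noteq> 0"
  shows "\<exists>w. diag_form d v w \<noteq> 0"
proof -
  obtain j where "v $ j \<noteq> 0"
    using assms by (auto simp: vec_eq_iff)
  then show ?thesis
    using assms by (intro exI[of _ "axis j 1"]) (simp add: diag_form_axis_right)
qed

theorem rb_J_eq:
  fixes d :: "'n::finite \<Rightarrow> 'a::field"
  assumes two: "(2::'a) \<noteq> 0" and d: "\<forall>j. d j \<noteq> 0" and card: "CARD('n) \<ge> 2"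
  shows "rb_J d = (if unit_null_pair (diag_form d) then 3
    else if takes_square_value (diag_form d) then 2 else 1)"
proof -
  note nd = diag_form_nondegenerate[OF d]
  consider "unit_null_pair (diag_form d)"
    | "\<not> unit_null_pair (diag_form d)" "takes_square_value (diag_form d)"
    | "\<not> unit_null_pair (diag_form d)" "\<not> takes_square_value (diag_form d)"
    by blast
  then show ?thesis
  proof cases
    case 1
    then have "\<exists>R. rota_baxter J_scale (J_mult (diag_form d)) R \<and> R ^^ (3 - 1) \<noteq> (\<lambda>_. 0)"
      using diag_form.rota_baxter_with_nonzero_square[OF two nd] by (force simp: unit_null_pair_def)
    then show ?thesis
      using 1 by (auto simp: rb_J_def intro!: rb_index_eqI diag_form.rota_baxter_cubed two)
  next
    case 2
    have "\<exists>R. rota_baxter J_scale (J_mult (diag_form d)) R \<and> R ^^ (2 - 1) \<noteq> (\<lambda>_. 0)"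
      using 2 diag_form.nonzero_rota_baxter[OF card] by (force simp: takes_square_value_def)
    moreover have "R ^^ 2 = (\<lambda>_. 0)" if "rota_baxter J_scale (J_mult (diag_form d)) R" for R
      using diag_form.unit_null_pair_if_square_nonzero[OF that two nd] 2
      by (auto simp: unit_null_pair_def numeral_2_eq_2 fun_eq_iff)
    ultimately show ?thesis
      using 2 by (auto simp: rb_J_def intro!: rb_index_eqI)
  next
    case 3
    have "R ^^ 1 = (\<lambda>_. 0)" if "rota_baxter J_scale (J_mult (diag_form d)) R" for R
      using diag_form.nonzero_square_value_if_nonzero[OF that] 3
      by (auto simp: takes_square_value_def)
    then show ?thesis
      using 3 by (auto simp: rb_J_def intro!: rb_index_eqI)
  qed
qed

section \<open>Quadratic forms over finite fields\<close>

lemma two_neq_0_if_CHAR_neq_2: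
  assumes "CHAR('a::field) \<noteq> 2"
  shows "(2::'a) \<noteq> 0"
proof
  assume "(2::'a) = 0"
  then have "CHAR('a) dvd 2"
    using of_nat_eq_0_iff_char_dvd[of 2, where 'a = 'a] by simp
  then have "CHAR('a) \<le> 2" "CHAR('a) \<noteq> 0"
    using dvd_imp_le[of "CHAR('a)" 2] by (auto intro!: Nat.gr0I)
  then show False
    using assms CHAR_not_1[where ?'a = 'a] by linarith
qed

text \<open>Every nonzero square has exactly two roots.\<close>

lemma card_squares:
  assumes fin: "finite (UNIV :: 'a::field set)" and two: "(2::'a) \<noteq> 0"
  shows "2 * card (range (\<lambda>x::'a. x ^ 2)) = CARD('a) + 1"
proof -
  let ?Q = "range (\<lambda>x::'a. x ^ 2)"
  have fiber: "card {x. x ^ 2 = s} = 2" if s: "s \<in> ?Q - {0}" for s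
  proof -
    obtain y where y: "s = y ^ 2"
      using s by auto
    then have "y \<noteq> 0"
      using s by auto
    moreover have "{x. x ^ 2 = s} = {y, - y}"
      by (auto simp: y power2_eq_iff)
    moreover have "y \<noteq> - y"
      using two \<open>y \<noteq> 0\<close> by (metis add.right_inverse mult_2 mult_eq_0_iff)
    ultimately show ?thesis
      by simp
  qed
  have fin': "finite ?Q"
    using fin by (rule finite_imageI)
  have "CARD('a) = (\<Sum>s\<in>?Q. card {x. x ^ 2 = s})"
    using sum.image_gen[OF fin, of "\<lambda>_. 1::nat" "\<lambda>x. x ^ 2"] by simp
  also have "\<dots> = card {x::'a. x ^ 2 = 0} + (\<Sum>s\<in>?Q - {0}. card {x. x ^ 2 = s})"
    using fin' by (intro sum.remove) (auto intro: range_eqI[of _ _ 0])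
  also have "\<dots> = 1 + 2 * card (?Q - {0})"
    by (simp add: fiber)
  also have "card (?Q - {0}) = card ?Q - 1"
    using fin' by (intro card_Diff_singleton) (auto intro: range_eqI[of _ _ 0])
  finally have "CARD('a) = 1 + 2 * (card ?Q - 1)" .
  moreover have "card ?Q > 0"
    using fin' by (simp add: card_gt_0_iff)
  ultimately show ?thesis
    by linarith
qed

text \<open>
  The sets of values \<open>a x\<^sup>2\<close> and \<open>e - b y\<^sup>2\<close> both contain more than half of the field, so they meet.
\<close>

lemma binary_form_universal:
  fixes a b e :: "'a::field"
  assumes fin: "finite (UNIV :: 'a set)" and two: "(2::'a) \<noteq> 0" and ab: "a \<noteq> 0" "b \<noteq> 0"
  obtains x y where "a * x ^ 2 + b * y ^ 2 = e"
proof -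
  let ?Q = "range (\<lambda>x::'a. x ^ 2)"
  let ?A = "(\<lambda>t. a * t) ` ?Q" and ?B = "(\<lambda>t. e - b * t) ` ?Q"
  have finS: "finite S" for S :: "'a set"
    using fin by (rule rev_finite_subset) simp
  have "card ?A = card ?Q" "card ?B = card ?Q"
    using ab by (auto intro!: card_image simp: inj_on_def)
  moreover have "card (?A \<union> ?B) \<le> CARD('a)"
    using fin by (intro card_mono) auto
  ultimately have "?A \<inter> ?B \<noteq> {}"
    using card_squares[OF fin two] card_Un_disjoint[of ?A ?B] finS by fastforce
  then obtain x y where "a * x ^ 2 = e - b * y ^ 2"
    by auto
  then show thesis
    by (intro that[of x y]) simp
qed

text \<open>
  Multiplication by a nonsquare \<open>a\<close> maps the squares into the set of nonsquares and \<open>0\<close>. Both sets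
  have \<open>(q + 1)/2\<close> elements if the field has \<open>q\<close>, so every nonsquare has the form \<open>a x\<^sup>2\<close>.
\<close>

lemma is_square_mult_nonsquares:
  fixes a b :: "'a::field"
  assumes fin: "finite (UNIV :: 'a set)" and two: "(2::'a) \<noteq> 0"
    and ab: "\<not> is_square a" "\<not> is_square b"
  shows "is_square (a * b)"
proof -
  let ?Q = "range (\<lambda>x::'a. x ^ 2)" and ?N = "{x::'a. x = 0 \<or> \<not> is_square x}"
  have finS: "finite S" for S :: "'a set"
    using fin by (rule rev_finite_subset) simp
  have Q: "?Q = {x. is_square x}"
    by (auto simp: is_nth_power_def)
  have a0: "a \<noteq> 0"
    using ab by auto
  have "?Q \<union> ?N = UNIV" "?Q \<inter> ?N = {0}"
    unfolding Q by auto
  then have "card ?N + card ?Q = CARD('a) + 1"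
    using card_Un_Int[OF finS finS, of ?Q ?N] by simp
  then have card_N: "card ?N = card ?Q"
    using card_squares[OF fin two] by linarith
  have sub: "(\<lambda>t. a * t) ` ?Q \<subseteq> ?N"
  proof clarsimp
    fix x assume "x \<noteq> 0" "is_square (a * x ^ 2)"
    then obtain y where "a * x ^ 2 = y ^ 2"
      by (auto elim: is_nth_powerE)
    then have "a = (y / x) ^ 2"
      using \<open>x \<noteq> 0\<close> by (simp add: power_divide field_simps)
    with ab show False
      using is_nth_powerI by blast
  qed
  have "card ((\<lambda>t. a * t) ` ?Q) = card ?N"
    using a0 card_N by (subst card_image) (auto simp: inj_on_def)
  then have "(\<lambda>t. a * t) ` ?Q = ?N"
    using sub finS by (intro card_subset_eq) auto
  then obtain x where "b = a * x ^ 2"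
    using ab by blast
  then have "a * b = (a * x) ^ 2"
    by (simp add: power2_eq_square algebra_simps)
  then show ?thesis
    by (rule is_nth_powerI)
qed

lemma is_square_mult_iff:
  fixes a b :: "'a::field"
  assumes fin: "finite (UNIV :: 'a set)" and two: "(2::'a) \<noteq> 0" and ab: "a \<noteq> 0" "b \<noteq> 0"
  shows "is_square (a * b) \<longleftrightarrow> (is_square a \<longleftrightarrow> is_square b)"
proof -
  have cancel: "is_square b" if "is_square (a * b)" "is_square a" "a \<noteq> 0" for a b :: 'a
  proof -
    obtain x y where "a * b = x ^ 2" "a = y ^ 2"
      using \<open>is_square (a * b)\<close> \<open>is_square a\<close> by (auto elim!: is_nth_powerE)
    then have "b = (x / y) ^ 2"
      using \<open>a \<noteq> 0\<close> by (auto simp: power_divide field_simps)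
    then show ?thesis
      by (rule is_nth_powerI)
  qed
  show ?thesis
    using cancel ab is_square_mult_nonsquares[OF fin two] is_nth_power_mult[of 2 a b]
    by (metis mult.commute)
qed

lemma is_square_prod_iff:
  fixes d :: "'b \<Rightarrow> 'a::field"
  assumes fin: "finite (UNIV :: 'a set)" and two: "(2::'a) \<noteq> 0"
    and "finite A" and "\<And>j. j \<in> A \<Longrightarrow> d j \<noteq> 0"
  shows "is_square (prod d A) \<longleftrightarrow> even (card {j \<in> A. \<not> is_square (d j)})"
  using assms(3,4)
proof (induction A rule: finite_induct)
  case (insert i A)
  have "{j \<in> insert i A. \<not> is_square (d j)} =
      (if is_square (d i) then {j \<in> A. \<not> is_square (d j)}
       else insert i {j \<in> A. \<not> is_square (d j)})"
    by auto
  then show ?case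
    using insert by (simp add: is_square_mult_iff[OF fin two])
qed simp

text \<open>Multiplication by \<open>a\<close> permutes the nonzero elements, so it preserves their product.\<close>

lemma power_card_minus_1:
  fixes a :: "'a::field"
  assumes fin: "finite (UNIV :: 'a set)" and a: "a \<noteq> 0"
  shows "a ^ (CARD('a) - 1) = 1"
proof -
  have "(\<Prod>x\<in>UNIV - {0}. a * x) = \<Prod>(UNIV - {0::'a})"
    using a by (intro prod.reindex_bij_witness[of _ "\<lambda>x. x / a" "\<lambda>x. a * x"]) auto
  then have "a ^ card (UNIV - {0::'a}) * \<Prod>(UNIV - {0::'a}) = \<Prod>(UNIV - {0::'a})"
    by (simp add: prod.distrib)
  moreover have "\<Prod>(UNIV - {0::'a}) \<noteq> 0"
    using fin by (subst prod_zero_iff) auto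
  ultimately show ?thesis
    using fin by (simp add: card_Diff_singleton)
qed

text \<open>
  The polynomial \<open>X\<^sup>2\<^sup>t - 1\<close> has at most \<open>2t\<close> roots, so it does not vanish at all \<open>4t\<close> nonzero
  elements. A nonzero \<open>x\<close> that is not a root satisfies \<open>x\<^sup>2\<^sup>t = - 1\<close>, because \<open>(x\<^sup>2\<^sup>t - 1)(x\<^sup>2\<^sup>t + 1) = x\<^sup>4\<^sup>t - 1 = 0\<close>; then \<open>x\<^sup>t\<close> is a root of \<open>- 1\<close>.
\<close>

lemma is_square_minus_1:
  assumes card: "CARD('a::field) = 4 * t + 1"
  shows "is_square (- 1 :: 'a)"
proof -
  have fin: "finite (UNIV :: 'a set)"
    using card by (intro card_ge_0_finite) simp
  have "CARD('a) \<noteq> 1"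
    using card_1_singletonE[of "UNIV :: 'a set"] by (metis UNIV_I singletonD zero_neq_one)
  with card have t: "t > 0"
    by simp
  let ?p = "Polynomial.monom 1 (2 * t) - 1 :: 'a poly"
  have "poly ?p 0 = - 1"
    using t by (simp add: poly_monom)
  then have p0: "?p \<noteq> 0"
    by (metis poly_0 neg_equal_0_iff_equal one_neq_zero)
  have "Polynomial.degree ?p \<le> 2 * t"
    by (intro degree_diff_le) (auto simp: degree_monom_le)
  then have "card {x. poly ?p x = 0} \<le> 2 * t"
    using card_poly_roots_bound[OF p0] by linarith
  moreover have "card (UNIV - {0::'a}) = 4 * t"
    using card fin by (simp add: card_Diff_singleton)
  ultimately have "\<not> UNIV - {0::'a} \<subseteq> {x. poly ?p x = 0}"
    using t fin card_mono[of "{x. poly ?p x = 0}" "UNIV - {0}"] finite_subset[OF _ fin] by fastforce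
  then obtain x :: 'a where x: "x \<noteq> 0" "x ^ (2 * t) \<noteq> 1"
    by (auto simp: poly_monom)
  have "(x ^ (2 * t) - 1) * (x ^ (2 * t) + 1) = x ^ (CARD('a) - 1) - 1"
    by (simp add: card algebra_simps flip: power_add)
  also have "\<dots> = 0"
    using power_card_minus_1[OF fin x(1)] by simp
  finally have "x ^ (2 * t) = - 1"
    using x(2) by (simp add: eq_neg_iff_add_eq_0)
  then have "- 1 = (x ^ t) ^ 2"
    by (simp add: mult.commute flip: power_mult)
  then show ?thesis
    by (rule is_nth_powerI)
qed

text \<open>If \<open>i\<^sup>2 = - 1\<close>, then \<open>1 = i ^ (q - 1) = (- 1) ^ ((q - 1)/2)\<close> for the order \<open>q\<close> of the field, and the last exponent is odd.\<close>

lemma not_is_square_minus_1: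
  assumes card: "CARD('a::field) = 4 * t + 3" and two: "(2::'a) \<noteq> 0"
  shows "\<not> is_square (- 1 :: 'a)"
proof
  assume "is_square (- 1 :: 'a)"
  then obtain i :: 'a where i: "- 1 = i ^ 2"
    by (auto elim: is_nth_powerE)
  have fin: "finite (UNIV :: 'a set)"
    using card by (intro card_ge_0_finite) simp
  have "i \<noteq> 0"
    using i by auto
  have "CARD('a) - 1 = 2 * (2 * t + 1)"
    by (simp add: card)
  then have "i ^ (CARD('a) - 1) = (- 1) ^ (2 * t + 1)"
    by (simp only: i power_mult)
  moreover have "i ^ (CARD('a) - 1) = 1"
    using fin \<open>i \<noteq> 0\<close> by (rule power_card_minus_1)
  ultimately have "(- 1 :: 'a) = 1"
    by simp
  then show False
    using two by (metis add.right_inverse one_add_one)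
qed

section \<open>Diagonal forms\<close>

lemmas diag_form_eval = diag_form.form_simps diag_form_axis

lemma unit_null_pair_if_squares:
  fixes d :: "'n::finite \<Rightarrow> 'a::field"
  assumes d: "\<forall>j. d j \<noteq> 0" and i: "i ^ 2 = (- 1 :: 'a)"
    and j: "j1 \<noteq> j2" "j1 \<noteq> j3" "j2 \<noteq> j3"
    and sq: "is_square (d j1)" "is_square (d j2)" "is_square (d j3)"
  shows "unit_null_pair (diag_form d)"
proof -
  obtain s1 s2 s3 where s: "d j1 = s1 ^ 2" "d j2 = s2 ^ 2" "d j3 = s3 ^ 2"
    using sq by (auto elim!: is_nth_powerE)
  then have nz: "s1 \<noteq> 0" "s2 \<noteq> 0" "s3 \<noteq> 0"
    using d by (metis zero_power2)+
  define u :: "'a ^ 'n" where "u = (1 / s1) *s axis j1 1"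
  define c where "c = (1 / s2) *s axis j2 1 + (i / s3) *s (axis j3 1 :: 'a ^ 'n)"
  have "diag_form d u u = 1" "diag_form d u c = 0"
    using j nz by (simp_all add: u_def c_def diag_form_eval s power2_eq_square)
  moreover have "diag_form d c c = 0"
    using j nz i by (simp add: c_def diag_form_eval s power2_eq_square)
  moreover have "c $ j2 \<noteq> 0"
    using j nz by (simp add: c_def axis_def)
  then have "c \<noteq> 0"
    by auto
  ultimately show ?thesis
    unfolding unit_null_pair_def by blast
qed

lemma takes_square_value_if_square:
  assumes "is_square (d j)"
  shows "takes_square_value (diag_form d)"
  unfolding takes_square_value_def
  using assms by (intro exI[of _ "axis j 1"]) (simp add: diag_form_axis axis_eq_0_iff)

lemma takes_square_value_finite:
  fixes d :: "'n::finite \<Rightarrow> 'a::field" and i j :: 'n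
  assumes fin: "finite (UNIV :: 'a set)" and two: "(2::'a) \<noteq> 0"
    and d: "\<forall>j. d j \<noteq> 0" and "i \<noteq> j"
  shows "takes_square_value (diag_form d)"
proof -
  obtain x y where xy: "d i * x ^ 2 + d j * y ^ 2 = 1"
    using binary_form_universal[OF fin two] d by metis
  define v where "v = x *s axis i 1 + y *s (axis j 1 :: 'a ^ 'n)"
  have "diag_form d v v = 1"
    using xy \<open>i \<noteq> j\<close> by (simp add: v_def diag_form_eval power2_eq_square algebra_simps)
  then have "v \<noteq> 0" "is_square (diag_form d v v)"
    by auto
  then show ?thesis
    unfolding takes_square_value_def by blast
qed

text \<open>
  Let \<open>u\<close> be a unit vector in the plane of \<open>e\<^sub>i\<close> and \<open>e\<^sub>j\<close>. The vector of that plane orthogonal to \<open>u\<close>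
  takes the value \<open>d\<^sub>i d\<^sub>j\<close>, so adding a vector \<open>w\<close> outside the plane with the opposite value yields
  an isotropic vector orthogonal to \<open>u\<close>.
\<close>

lemma unit_null_pair_if_binary_value:
  fixes d :: "'n::finite \<Rightarrow> 'a::field"
  assumes fin: "finite (UNIV :: 'a set)" and two: "(2::'a) \<noteq> 0"
    and d: "\<forall>j. d j \<noteq> 0" and ij: "i \<noteq> j"
    and w: "w $ i = 0" "w $ j = 0" "diag_form d w w = - d i * d j"
  shows "unit_null_pair (diag_form d)"
proof -
  obtain x y where xy: "d i * x ^ 2 + d j * y ^ 2 = 1"
    using binary_form_universal[OF fin two] d by metis
  define u where "u = x *s axis i 1 + y *s (axis j 1 :: 'a ^ 'n)"
  define c where "c = (- d j * y) *s axis i 1 + (d i * x) *s (axis j 1 :: 'a ^ 'n) + w"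
  have w': "diag_form d (axis i 1) w = 0" "diag_form d (axis j 1) w = 0"
    "diag_form d w (axis i 1) = 0" "diag_form d w (axis j 1) = 0"
    using w diag_form.sym[of d] by (simp_all add: diag_form_axis_right)
  have "diag_form d u u = 1"
    using xy ij by (simp add: u_def diag_form_eval power2_eq_square algebra_simps)
  moreover have "diag_form d u c = 0"
    using ij by (simp add: u_def c_def diag_form_eval w')
  moreover have "diag_form d c c = d i * d j * (d i * x ^ 2 + d j * y ^ 2) - d i * d j"
    using ij by (simp add: c_def diag_form_eval w' w(3) power2_eq_square algebra_simps)
  moreover have "c \<noteq> 0"
  proof
    assume "c = 0"
    then have "c $ i = 0" "c $ j = 0"
      by simp_all
    then have "x = 0" "y = 0"
      using ij w d by (auto simp: c_def axis_def)
    with xy show False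
      by simp
  qed
  ultimately show ?thesis
    unfolding unit_null_pair_def xy by auto
qed

lemma ex_distinct:
  assumes "card S \<ge> n"
  obtains xs where "distinct xs" "length xs = n" "set xs \<subseteq> S"
  using assms by (metis distinct_card finite_distinct_list obtain_subset_with_card_n)

lemma unit_null_pair_finite_4:
  fixes d :: "'n::finite \<Rightarrow> 'a::field"
  assumes fin: "finite (UNIV :: 'a set)" and two: "(2::'a) \<noteq> 0"
    and d: "\<forall>j. d j \<noteq> 0" and card: "CARD('n) \<ge> 4"
  shows "unit_null_pair (diag_form d)"
proof -
  obtain xs :: "'n list" where xs: "distinct xs" "length xs = 4"
    using ex_distinct[OF card] .
  then obtain i j k l where "xs = [i, j, k, l]"
    by (auto simp: length_Suc_conv numeral_eq_Suc)
  with xs have dist: "i \<noteq> j" "i \<noteq> k" "i \<noteq> l" "j \<noteq> k" "j \<noteq> l" "k \<noteq> l"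
    by auto
  obtain a b where ab: "d k * a ^ 2 + d l * b ^ 2 = - d i * d j"
    using binary_form_universal[OF fin two] d by metis
  define w where "w = a *s axis k 1 + b *s (axis l 1 :: 'a ^ 'n)"
  have "diag_form d w w = d k * a ^ 2 + d l * b ^ 2"
    using dist by (simp add: w_def diag_form_eval power2_eq_square algebra_simps)
  then show ?thesis
    using ab dist by (intro unit_null_pair_if_binary_value[OF fin two d, of i j w])
      (simp_all add: w_def axis_def)
qed

lemma lagrange_identity:
  fixes a b x y z w :: "'a::comm_ring_1"
  shows "a * b * (x * w - y * z) ^ 2 =
    (a * x * x + b * y * y) * (a * z * z + b * w * w) - (a * x * z + b * y * w) ^ 2"
  by (simp add: power2_eq_square ring_distribs mult_ac)

text \<open>
  If \<open>u\<close>, \<open>c\<close> are a pair as required and \<open>c\<^sub>i \<noteq> 0\<close>, then the Gram determinant of \<open>u, c, e\<^sub>i\<close> is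
  \<open>- f(c, e\<^sub>i)\<^sup>2 = - (d\<^sub>i c\<^sub>i)\<^sup>2\<close>; on the other hand it is \<open>d\<^sub>1 d\<^sub>2 d\<^sub>3 m\<^sup>2\<close>, where \<open>m\<close> is the remaining
  \<open>2 \<times> 2\<close> minor of \<open>u\<close> and \<open>c\<close>. Lagrange's identity expresses this comparison without determinants.
  Conversely, a root of \<open>- d\<^sub>1 d\<^sub>2 d\<^sub>3\<close> gives a multiple of \<open>e\<^sub>k\<close> with the value \<open>- d\<^sub>i d\<^sub>j\<close>.
\<close>

lemma unit_null_pair_finite_3_iff:
  fixes d :: "'n::finite \<Rightarrow> 'a::field"
  assumes fin: "finite (UNIV :: 'a set)" and two: "(2::'a) \<noteq> 0"
    and d: "\<forall>j. d j \<noteq> 0" and card: "CARD('n) = 3"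
  shows "unit_null_pair (diag_form d) \<longleftrightarrow> is_square (- prod d UNIV)"
proof
  assume "unit_null_pair (diag_form d)"
  then obtain u c where uc: "diag_form d u u = 1" "c \<noteq> 0" "diag_form d c c = 0" "diag_form d u c = 0"
    unfolding unit_null_pair_def by blast
  obtain i where ci: "c $ i \<noteq> 0"
    using uc by (auto simp: vec_eq_iff)
  have "card (UNIV - {i}) = 2"
    using card by simp
  then obtain j k where jk: "UNIV - {i} = {j, k}" "j \<noteq> k"
    by (meson card_2_iff)
  then have U: "UNIV = {i, j, k}" and ne: "i \<noteq> j" "i \<noteq> k"
    by auto
  have expand: "diag_form d v w = d i * v $ i * w $ i + d j * v $ j * w $ j + d k * v $ k * w $ k" for v w
    unfolding diag_form_def U using ne jk(2) by (simp add: add.assoc)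
  define m where "m = u $ j * c $ k - u $ k * c $ j"
  have rest:
    "d j * u $ j * u $ j + d k * u $ k * u $ k = 1 - d i * u $ i * u $ i"
    "d j * c $ j * c $ j + d k * c $ k * c $ k = - (d i * c $ i * c $ i)"
    "d j * u $ j * c $ j + d k * u $ k * c $ k = - (d i * u $ i * c $ i)"
    using uc(1,3,4) unfolding expand by (simp_all add: algebra_simps eq_neg_iff_add_eq_0)
  have gram: "d j * d k * m ^ 2 = - (d i * c $ i ^ 2)"
    unfolding m_def lagrange_identity rest by (simp add: power2_eq_square algebra_simps)
  then have "m \<noteq> 0"
    using d ci by auto
  have "- prod d UNIV = - (d i * (d j * d k))"
    unfolding U using ne jk(2) by (simp add: mult.assoc)
  also have "\<dots> = (d i * c $ i / m) ^ 2"
    using gram \<open>m \<noteq> 0\<close> by (simp add: field_simps power2_eq_square)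
  finally show "is_square (- prod d UNIV)"
    by (rule is_nth_powerI)
next
  assume "is_square (- prod d UNIV)"
  then obtain s where s: "- prod d UNIV = s ^ 2"
    by (auto elim: is_nth_powerE)
  obtain i j k where U: "(UNIV :: 'n set) = {i, j, k}"
    and ne: "i \<noteq> j" "j \<noteq> k" "i \<noteq> k"
    using card by (meson card_3_iff)
  have s': "s ^ 2 = - (d i * d j) * d k"
    unfolding s[symmetric] U using ne by (simp add: mult.assoc)
  define w where "w = (s / d k) *s (axis k 1 :: 'a ^ 'n)"
  have "diag_form d w w = s ^ 2 / d k"
    using d by (simp add: w_def diag_form_eval power2_eq_square)
  also have "\<dots> = - d i * d j"
    using d by (simp add: s')
  finally show "unit_null_pair (diag_form d)"
    using ne by (intro unit_null_pair_if_binary_value[OF fin two d, of i j w])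
      (simp_all add: w_def axis_def)
qed

text \<open>
  The Gram determinant of \<open>u\<close> and \<open>c\<close> vanishes, so \<open>c\<close> is proportional to the anisotropic vector \<open>u\<close>
  and orthogonal to it at the same time.
\<close>

lemma not_unit_null_pair_2:
  fixes d :: "'n::finite \<Rightarrow> 'a::field"
  assumes d: "\<forall>j. d j \<noteq> 0" and card: "CARD('n) = 2"
  shows "\<not> unit_null_pair (diag_form d)"
proof
  assume "unit_null_pair (diag_form d)"
  then obtain u c where uc: "diag_form d u u = 1" "c \<noteq> 0" "diag_form d c c = 0" "diag_form d u c = 0"
    unfolding unit_null_pair_def by blast
  obtain i j where U: "(UNIV :: 'n set) = {i, j}" and ne: "i \<noteq> j"
    using card by (meson card_2_iff)
  have expand: "diag_form d v w = d i * v $ i * w $ i + d j * v $ j * w $ j" for v w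
    unfolding diag_form_def U using ne by simp
  have "d i * d j * (u $ i * c $ j - u $ j * c $ i) ^ 2 = 0"
    using uc(1,3,4) unfolding expand lagrange_identity by simp
  then have "u $ i * c $ j = u $ j * c $ i"
    using d by auto
  then have cross: "u $ j * c $ i = u $ i * c $ j"
    by simp
  have "diag_form d u u * c $ i = d i * u $ i * u $ i * c $ i + d j * u $ j * (u $ j * c $ i)"
    by (simp add: expand algebra_simps)
  also have "\<dots> = u $ i * diag_form d u c"
    unfolding cross by (simp add: expand algebra_simps)
  finally have "c $ i = 0"
    using uc by simp
  moreover have "diag_form d u u * c $ j = d i * u $ i * (u $ i * c $ j) + d j * u $ j * u $ j * c $ j"
    by (simp add: expand algebra_simps)
  moreover have "\<dots> = u $ j * diag_form d u c"
    unfolding cross[symmetric] by (simp add: expand algebra_simps)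
  ultimately have "c $ i = 0" "c $ j = 0"
    using uc by simp_all
  then have "c $ l = 0" for l
    using UNIV_I[of l] unfolding U by auto
  then have "c = 0"
    by (simp add: vec_eq_iff)
  with uc show False
    by simp
qed

lemma num_quadratic_residues_add:
  fixes d :: "'n::finite \<Rightarrow> 'a::field"
  assumes "\<forall>j. d j \<noteq> 0"
  shows "num_quadratic_residues d + card {j. \<not> is_square (d j)} = CARD('n)"
proof -
  have "num_quadratic_residues d = card {j. is_square (d j)}"
    using assms by (simp add: num_quadratic_residues_def quadratic_residue_def)
  moreover have "{j. is_square (d j)} \<union> {j. \<not> is_square (d j)} = UNIV"
    "{j. is_square (d j)} \<inter> {j. \<not> is_square (d j)} = {}"
    by auto
  ultimately show ?thesis
    using card_Un_disjoint[of "{j. is_square (d j)}" "{j. \<not> is_square (d j)}"] by simp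
qed

lemma unit_null_pair_finite_3_parity:
  fixes d :: "'n::finite \<Rightarrow> 'a::field"
  assumes fin: "finite (UNIV :: 'a set)" and two: "(2::'a) \<noteq> 0"
    and d: "\<forall>j. d j \<noteq> 0" and card: "CARD('n) = 3"
  shows "unit_null_pair (diag_form d) \<longleftrightarrow>
    (is_square (- 1 :: 'a) \<longleftrightarrow> odd (num_quadratic_residues d))"
proof -
  have "prod d UNIV \<noteq> 0"
    using d by simp
  then have "unit_null_pair (diag_form d) \<longleftrightarrow> (is_square (- 1 :: 'a) \<longleftrightarrow> is_square (prod d UNIV))"
    using is_square_mult_iff[OF fin two, of "- 1" "prod d UNIV"]
    by (simp add: unit_null_pair_finite_3_iff[OF assms])
  also have "is_square (prod d UNIV) \<longleftrightarrow> odd (num_quadratic_residues d)"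
    using is_square_prod_iff[OF fin two, of UNIV d] d num_quadratic_residues_add[OF d] card
    by (metis (no_types, lifting) UNIV_I Collect_cong even_add finite odd_numeral)
  finally show ?thesis .
qed

section \<open>The value of the index\<close>

lemma is_square_real_iff: "is_square (x::real) \<longleftrightarrow> x \<ge> 0"
  using is_nth_powerI[of x "sqrt x" 2] by (auto elim: is_nth_powerE)

text \<open>
  The only case that is not read off from the signs at once is that of a single positive entry \<open>d\<^sub>i\<close>.
  There \<open>f\<close> is negative definite on the hyperplane \<open>v\<^sub>i = 0\<close>, which contains \<open>c - su\<close> for
  \<open>s = c\<^sub>i/u\<^sub>i\<close>; but \<open>f(c - su, c - su) = s\<^sup>2\<close>. So \<open>c = su\<close>, and \<open>c\<close> would not be isotropic.
\<close>

lemma rb_J_real: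
  fixes d :: "'n::finite \<Rightarrow> real"
  assumes d: "\<forall>j. d j \<noteq> 0" and card: "CARD('n) \<ge> 2"
  shows "rb_J d =
    (if \<forall>j. d j < 0 then 1
     else if (\<forall>j. d j > 0) \<or> (\<exists>i. d i > 0 \<and> (\<forall>j. j \<noteq> i \<longrightarrow> d j < 0)) then 2
     else 3)"
proof -
  have two: "(2::real) \<noteq> 0"
    by simp
  have expand: "diag_form d v v = (\<Sum>j\<in>UNIV. d j * (v $ j)\<^sup>2)" for v
    by (simp add: diag_form_def power2_eq_square mult.assoc)
  have nonpos: "(\<Sum>j\<in>S. d j * (v $ j)\<^sup>2) < 0" if "\<forall>j\<in>S. d j < 0" "i \<in> S" "v $ i \<noteq> 0" for S i v
  proof -
    have "(\<Sum>j\<in>S. d j * (v $ j)\<^sup>2) < (\<Sum>j\<in>S. 0)"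
      using that by (intro sum_strict_mono_ex1 bexI[of _ i])
        (auto simp: mult_nonpos_nonneg mult_neg_pos less_imp_le)
    then show ?thesis
      by simp
  qed
  consider "\<forall>j. d j < 0" | i where "d i > 0" "\<forall>j. d j > 0"
    | i where "d i > 0" "\<forall>j. j \<noteq> i \<longrightarrow> d j < 0"
    | i j k where "d i > 0" "d j > 0" "i \<noteq> j" "d k < 0"
    using d by (metis linorder_neqE_linordered_idom)
  then show ?thesis
  proof cases
    case 1
    have "\<not> is_square (diag_form d v v)" if "v \<noteq> 0" for v
      using nonpos[of UNIV _ v] 1 that by (auto simp: is_square_real_iff expand vec_eq_iff not_le)
    then have "\<not> takes_square_value (diag_form d)"
      by (auto simp: takes_square_value_def)
    moreover have "\<not> unit_null_pair (diag_form d)"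
      using calculation by (metis is_nth_power_0_iff pos2 takes_square_value_def unit_null_pair_def)
    ultimately show ?thesis
      using 1 by (simp add: rb_J_eq[OF two d card])
  next
    case 2
    have "diag_form d c c > 0" if c: "c \<noteq> 0" for c
    proof -
      obtain i where "c $ i \<noteq> 0"
        using c by (auto simp: vec_eq_iff)
      then show ?thesis
        unfolding expand using 2 by (intro sum_pos2[of _ i]) (auto simp: less_imp_le)
    qed
    then have "\<not> unit_null_pair (diag_form d)"
      by (force simp: unit_null_pair_def)
    moreover have "takes_square_value (diag_form d)"
      using 2 by (intro takes_square_value_if_square[of _ i]) (simp add: is_square_real_iff less_imp_le)
    ultimately show ?thesis
      using 2 by (auto simp: rb_J_eq[OF two d card] not_less_iff_gr_or_eq)
  next
    case 3
    have "\<not> unit_null_pair (diag_form d)"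
    proof
      assume "unit_null_pair (diag_form d)"
      then obtain u c where uc: "diag_form d u u = 1" "c \<noteq> 0" "diag_form d c c = 0" "diag_form d u c = 0"
        unfolding unit_null_pair_def by blast
      have neg: "diag_form d v v < 0" if v: "v $ i = 0" "v \<noteq> 0" for v
      proof -
        obtain j where "v $ j \<noteq> 0"
          using v by (auto simp: vec_eq_iff)
        then have "(\<Sum>j\<in>UNIV - {i}. d j * (v $ j)\<^sup>2) < 0"
          using v 3 by (intro nonpos[of _ j]) auto
        then show ?thesis
          using v by (simp add: expand sum.remove[of UNIV i])
      qed
      have "u \<noteq> 0"
        using uc by auto
      then have ui: "u $ i \<noteq> 0"
        using neg[of u] uc by auto
      define s where "s = c $ i / u $ i"
      have "diag_form d (c - s *s u) (c - s *s u) = s ^ 2"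
        using uc diag_form.sym[of d c u] by (simp add: diag_form.form_simps power2_eq_square)
      moreover have "(c - s *s u) $ i = 0"
        using ui by (simp add: s_def)
      ultimately have cs: "c = s *s u"
        using neg[of "c - s *s u"] by (metis eq_iff_diff_eq_0 not_less zero_le_power2)
      then have "s = 0"
        using uc by (simp add: diag_form.form_simps)
      with cs uc show False
        by simp
    qed
    moreover have "takes_square_value (diag_form d)"
      using 3 by (intro takes_square_value_if_square[of _ i]) (simp add: is_square_real_iff less_imp_le)
    moreover have "\<not> (\<forall>j. d j < 0)"
      using 3 by (meson less_asym)
    moreover have "\<exists>i. d i > 0 \<and> (\<forall>j. j \<noteq> i \<longrightarrow> d j < 0)"
      using 3 by blast
    ultimately show ?thesis
      by (simp only: rb_J_eq[OF two d card] simp_thms if_True if_False)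
  next
    case 4
    define u :: "real ^ 'n" where "u = (1 / sqrt (d i)) *s axis i 1"
    define c where "c = (1 / sqrt (d j)) *s axis j 1 + (1 / sqrt (- d k)) *s (axis k 1 :: real ^ 'n)"
    have ne: "i \<noteq> k" "j \<noteq> k"
      using 4 by auto
    have "diag_form d u u = 1" "diag_form d u c = 0"
      using 4 ne by (simp_all add: u_def c_def diag_form_eval field_simps)
    moreover have "diag_form d c c = 0"
      using 4 ne by (simp add: c_def diag_form_eval field_simps)
    moreover have "c $ j \<noteq> 0"
      using 4 ne by (simp add: c_def axis_def)
    then have "c \<noteq> 0"
      by auto
    ultimately have "unit_null_pair (diag_form d)"
      unfolding unit_null_pair_def by blast
    moreover have "\<not> (\<exists>i. d i > 0 \<and> (\<forall>j. j \<noteq> i \<longrightarrow> d j < 0))"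
      using 4 by (metis less_asym)
    moreover have "\<not> (\<forall>j. d j < 0)" "\<not> (\<forall>j. d j > 0)"
      using 4 by (meson less_asym)+
    ultimately show ?thesis
      by (simp add: rb_J_eq[OF two d card])
  qed
qed

lemma rb_J_finite_ge_4:
  fixes d :: "'n::finite \<Rightarrow> 'a::field"
  assumes fin: "finite (UNIV :: 'a set)" and two: "(2::'a) \<noteq> 0"
    and d: "\<forall>j. d j \<noteq> 0" and card: "CARD('n) \<ge> 4"
  shows "rb_J d = 3"
  using unit_null_pair_finite_4[OF assms] rb_J_eq[OF two d] card by simp

lemma rb_J_finite_le_3:
  fixes d :: "'n::finite \<Rightarrow> 'a::field"
  assumes fin: "finite (UNIV :: 'a set)" and two: "(2::'a) \<noteq> 0"
    and d: "\<forall>j. d j \<noteq> 0" and card: "CARD('n) = 2 \<or> CARD('n) = 3"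
  shows "rb_J d = (if CARD('n) = 3 \<and>
    (is_square (- 1 :: 'a) \<longleftrightarrow> odd (num_quadratic_residues d)) then 3 else 2)"
proof -
  have card2: "CARD('n) \<ge> 2"
    using card by auto
  obtain xs :: "'n list" where xs: "distinct xs" "length xs = 2"
    using ex_distinct[OF card2] .
  then obtain i j where "i \<noteq> (j::'n)"
    by (auto simp: length_Suc_conv numeral_eq_Suc)
  then have "takes_square_value (diag_form d)"
    by (rule takes_square_value_finite[OF fin two d])
  then show ?thesis
    using card unit_null_pair_finite_3_parity[OF fin two d] not_unit_null_pair_2[OF d]
    by (auto simp: rb_J_eq[OF two d card2])
qed

lemma two_neq_0_if_odd_card:
  assumes "odd CARD('a::field)"
  shows "(2::'a) \<noteq> 0"
  using assms CHAR_dvd_CARD[where ?'a = 'a] by (intro two_neq_0_if_CHAR_neq_2) auto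

theorem theorem2:
  shows
   "(\<forall>d :: 'n::finite \<Rightarrow> 'a::field.
        CHAR('a) \<noteq> 2 \<and> CARD('n) \<ge> 3 \<and> (\<forall>j. d j \<noteq> 0) \<and>
        (\<exists>i::'a. i ^ 2 = - 1) \<and>
        (\<exists>j1 j2 j3. j1 \<noteq> j2 \<and> j1 \<noteq> j3 \<and> j2 \<noteq> j3 \<and>
           is_square (d j1) \<and> is_square (d j2) \<and> is_square (d j3))
        \<longrightarrow> rb_J d = 3)
    \<and>
    (\<forall>d :: 'n \<Rightarrow> real.
        CARD('n) \<ge> 3 \<and> (\<forall>j. d j \<noteq> 0)
        \<longrightarrow> rb_J d =
          (if \<forall>j. d j < 0 then 1
           else if (\<forall>j. d j > 0) \<or> (\<exists>i. d i > 0 \<and> (\<forall>j. j \<noteq> i \<longrightarrow> d j < 0)) then 2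
           else 3))
    \<and>
    (\<forall>(k::nat) (d :: 'n \<Rightarrow> 'a).
        CHAR('a) \<noteq> 2 \<and> finite (UNIV :: 'a set) \<and>
        k \<ge> 6 \<and> k = CARD('n) + 1 \<and> (\<forall>j. d j \<noteq> 0)
        \<longrightarrow> rb_J d = 3)
    \<and>
    (\<forall>(p::nat) (k::nat) (d :: 'n \<Rightarrow> 'a).
        prime p \<and> CARD('a) = p \<and> (\<exists>t. p = 4 * t + 1) \<and>
        k \<ge> 3 \<and> k = CARD('n) + 1 \<and> (\<forall>j. d j \<noteq> 0)
        \<longrightarrow> (k = 3 \<or> (k = 4 \<and> even (num_quadratic_residues d)) \<longrightarrow> rb_J d = 2) \<and>
            (k \<ge> 5 \<or> (k = 4 \<and> odd (num_quadratic_residues d)) \<longrightarrow> rb_J d = 3))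
    \<and>
    (\<forall>(p::nat) (k::nat) (d :: 'n \<Rightarrow> 'a).
        prime p \<and> CARD('a) = p \<and> (\<exists>t. p = 4 * t + 3) \<and>
        k \<ge> 3 \<and> k = CARD('n) + 1 \<and> (\<forall>j. d j \<noteq> 0)
        \<longrightarrow> (k = 3 \<or> (k = 4 \<and> odd (num_quadratic_residues d)) \<longrightarrow> rb_J d = 2) \<and>
            (k \<ge> 5 \<or> (k = 4 \<and> even (num_quadratic_residues d)) \<longrightarrow> rb_J d = 3))"
proof (intro conjI allI impI; elim conjE exE)
  fix d :: "'n \<Rightarrow> 'a" and i :: 'a and j1 j2 j3
  assume *: "CHAR('a) \<noteq> 2" "CARD('n) \<ge> 3" "\<forall>j. d j \<noteq> 0" "i ^ 2 = - 1"
    "j1 \<noteq> j2" "j1 \<noteq> j3" "j2 \<noteq> j3" "is_square (d j1)" "is_square (d j2)" "is_square (d j3)"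
  then have "unit_null_pair (diag_form d)"
    by (intro unit_null_pair_if_squares)
  then show "rb_J d = 3"
    using * by (simp add: rb_J_eq two_neq_0_if_CHAR_neq_2)
next
  fix d :: "'n \<Rightarrow> real"
  assume "CARD('n) \<ge> 3" "\<forall>j. d j \<noteq> 0"
  then show "rb_J d =
      (if \<forall>j. d j < 0 then 1
       else if (\<forall>j. d j > 0) \<or> (\<exists>i. d i > 0 \<and> (\<forall>j. j \<noteq> i \<longrightarrow> d j < 0)) then 2
       else 3)"
    by (intro rb_J_real) auto
next
  fix k :: nat and d :: "'n \<Rightarrow> 'a"
  assume "CHAR('a) \<noteq> 2" "finite (UNIV :: 'a set)" "k \<ge> 6" "k = CARD('n) + 1" "\<forall>j. d j \<noteq> 0"
  then show "rb_J d = 3"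
    by (intro rb_J_finite_ge_4 two_neq_0_if_CHAR_neq_2) auto
next
  fix p k t :: nat and d :: "'n \<Rightarrow> 'a"
  assume *: "CARD('a) = p" "p = 4 * t + 1" "k = CARD('n) + 1" "\<forall>j. d j \<noteq> 0"
  then have sq: "is_square (- 1 :: 'a)" and fin: "finite (UNIV :: 'a set)"
    by (auto intro: is_square_minus_1 card_ge_0_finite)
  have two: "(2::'a) \<noteq> 0"
    using * by (intro two_neq_0_if_odd_card) simp
  show "rb_J d = 2" if "k = 3 \<or> k = 4 \<and> even (num_quadratic_residues d)"
    using that * sq by (subst rb_J_finite_le_3[OF fin two]) auto
  show "rb_J d = 3" if "k \<ge> 5 \<or> k = 4 \<and> odd (num_quadratic_residues d)"
    using that
  proof
    assume "k \<ge> 5"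
    then show ?thesis
      using * by (intro rb_J_finite_ge_4[OF fin two]) auto
  qed (use * sq in \<open>subst rb_J_finite_le_3[OF fin two]; auto\<close>)
next
  fix p k t :: nat and d :: "'n \<Rightarrow> 'a"
  assume *: "CARD('a) = p" "p = 4 * t + 3" "k = CARD('n) + 1" "\<forall>j. d j \<noteq> 0"
  then have fin: "finite (UNIV :: 'a set)"
    by (auto intro: card_ge_0_finite)
  have two: "(2::'a) \<noteq> 0"
    using * by (intro two_neq_0_if_odd_card) simp
  have sq: "\<not> is_square (- 1 :: 'a)"
    using * two by (intro not_is_square_minus_1) auto
  show "rb_J d = 2" if "k = 3 \<or> k = 4 \<and> odd (num_quadratic_residues d)"
    using that * sq by (subst rb_J_finite_le_3[OF fin two]) auto
  show "rb_J d = 3" if "k \<ge> 5 \<or> k = 4 \<and> even (num_quadratic_residues d)"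
    using that
  proof
    assume "k \<ge> 5"
    then show ?thesis
      using * by (intro rb_J_finite_ge_4[OF fin two]) auto
  qed (use * sq in \<open>subst rb_J_finite_le_3[OF fin two]; auto\<close>)
qed

end
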